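(* Let $q$ be a prime power, $n=tt'$ with integers $t,t'\ge2$, $\mathbf a=(a_0,\dots,a_{t'-1})\in\mathbb{F}_{q^n}^{t'}$ such that $g_{\mathbf a}(x)=\sum_{i=0}^{t'-1}a_ix^{q^{it}}$ is bijective on $\mathbb{F}_{q^n}$. Let $\gamma=q^j$ where $x\mapsto x^{q^j}$ generates $\mathrm{Gal}(\mathbb{F}_{q^t}/\mathbb{F}_q)$ (i.e. $\gcd(j,t)=1$), write $x^\gamma=x^{q^j}$, and let $k\in\mathbb{N}$. Then the code $\langle g_{\mathbf a}(x^\gamma),x^{q^{kt}}\rangle_{\mathbb{F}_{q^n}}=\{\alpha g_{\mathbf a}(x^\gamma)+\beta x^{q^{kt}}\colon \alpha,\beta\in\mathbb{F}_{q^n}\}$ is an $s$-almost MRD-code in $\mathbb{F}_q^{n\times n}$ for some $s\le n/t-1$.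
   Context: Each $\mathbb{F}_q$-linear map of $\mathbb{F}_{q^n}$ is identified (via an $\mathbb{F}_q$-basis) with a matrix in $\mathbb{F}_q^{n\times n}$; a rank metric code is an $\mathbb{F}_q$-subspace $\mathcal C$ of $\mathbb{F}_q^{\ell\times n}$ with distance $d(A,B)=\mathrm{rk}(A-B)$ and minimum distance $d=\min\{\mathrm{rk}(A-B)\colon A\ne B\in\mathcal C\}$. The Singleton-like bound states $\dim_{\mathbb{F}_q}\mathcal C\le\max\{\ell,n\}(\min\{\ell,n\}-d+1)$; let $d^*$ be the largest $d$ allowed by this bound for the given dimension. $\mathcal C$ is an $s$-almost MRD-code if its minimum distance equals $d^*-s$. *)

theory Defs
  imports "HOL-Analysis.Analysis"
begin

text \<open>The type \<open>'k ^ 'n ^ 'l\<close> consists of the matrices with rows indexed by \<open>'l\<close> and columns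
  indexed by \<open>'n\<close>.\<close>

definition mat_smult :: "'k::field \<Rightarrow> 'k ^ 'n ^ 'l \<Rightarrow> 'k ^ 'n ^ 'l" where
  "mat_smult c A = (\<chi> i j. c * A $ i $ j)"

global_interpretation mat_vs: vector_space "mat_smult :: 'k::field \<Rightarrow> 'k ^ 'n ^ 'l \<Rightarrow> 'k ^ 'n ^ 'l"
  by unfold_locales (simp_all add: mat_smult_def vec_eq_iff algebra_simps)

definition min_distance :: "('k::field ^ 'n ^ 'l) set \<Rightarrow> nat" where
  "min_distance C = Min {rank (A - B) | A B. A \<in> C \<and> B \<in> C \<and> A \<noteq> B}"

text \<open>The Singleton-like bound for a code of dimension \<open>k\<close> and minimum distance \<open>d\<close> in the
  \<open>l \<times> n\<close> matrices. It is stated over the integers so that \<open>d > min l n + 1\<close> is excluded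
  rather than truncated.\<close>

definition singleton_like_bound :: "nat \<Rightarrow> nat \<Rightarrow> nat \<Rightarrow> nat \<Rightarrow> bool" where
  "singleton_like_bound l n k d \<longleftrightarrow> int k \<le> int (max l n) * (int (min l n) - int d + 1)"

definition max_distance :: "('k::field ^ 'n ^ 'l) set \<Rightarrow> nat" where
  "max_distance C = Max {d. singleton_like_bound CARD('l) CARD('n) (mat_vs.dim C) d}"

text \<open>The zero code is excluded because it has no minimum distance (the minimum would range over
  the empty set). The equation is \<open>d = d\<^sup>* - s\<close> without truncated subtraction.\<close>

definition almost_MRD :: "nat \<Rightarrow> ('k::field ^ 'n ^ 'l) set \<Rightarrow> bool" where
  "almost_MRD s C \<longleftrightarrow>
     mat_vs.subspace C \<and> (\<exists>A\<in>C. A \<noteq> 0) \<and> min_distance C + s = max_distance C"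

text \<open>An extension of \<open>'k\<close> by \<open>'a\<close> is given by a ring homomorphism \<open>\<iota>\<close>, which makes \<open>'a\<close>
  a vector space over \<open>'k\<close>.\<close>

definition field_embedding :: "('k::field \<Rightarrow> 'a::field) \<Rightarrow> bool" where
  "field_embedding \<iota> \<longleftrightarrow>
     \<iota> 1 = 1 \<and> (\<forall>x y. \<iota> (x + y) = \<iota> x + \<iota> y) \<and> (\<forall>x y. \<iota> (x * y) = \<iota> x * \<iota> y)"

definition ext_scale :: "('k::field \<Rightarrow> 'a::field) \<Rightarrow> 'k \<Rightarrow> 'a \<Rightarrow> 'a" where
  "ext_scale \<iota> c x = \<iota> c * x"

lemma vector_space_ext_scale: "field_embedding \<iota> \<Longrightarrow> vector_space (ext_scale \<iota>)"
  by unfold_locales (simp_all add: ext_scale_def field_embedding_def algebra_simps)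

definition is_ext_basis :: "('k::field \<Rightarrow> 'a::field) \<Rightarrow> ('n \<Rightarrow> 'a) \<Rightarrow> bool" where
  "is_ext_basis \<iota> b \<longleftrightarrow>
     inj b \<and> \<not> module.dependent (ext_scale \<iota>) (range b) \<and> module.span (ext_scale \<iota>) (range b) = UNIV"

text \<open>Column \<open>j\<close> holds the coordinates of \<open>f (b j)\<close> with respect to the basis \<open>b\<close>.\<close>

definition matrix_of_map :: "('k::field \<Rightarrow> 'a::field) \<Rightarrow> ('n \<Rightarrow> 'a) \<Rightarrow> ('a \<Rightarrow> 'a) \<Rightarrow> 'k ^ 'n ^ 'n" where
  "matrix_of_map \<iota> b f =
     (\<chi> i j. module.representation (ext_scale \<iota>) (range b) (f (b j)) (b i))"

definition g_poly :: "nat \<Rightarrow> nat \<Rightarrow> nat \<Rightarrow> (nat \<Rightarrow> 'a) \<Rightarrow> 'a \<Rightarrow> 'a::field" where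
  "g_poly q t t' a x = (\<Sum>i<t'. a i * x ^ (q ^ (i * t)))"

definition span2 :: "('a \<Rightarrow> 'a) \<Rightarrow> ('a \<Rightarrow> 'a) \<Rightarrow> ('a \<Rightarrow> 'a::field) set" where
  "span2 f h = {\<lambda>x. \<alpha> * f x + \<beta> * h x | \<alpha> \<beta>. True}"

end

theory Submission
  imports Defs "HOL-Computational_Algebra.Polynomial"
begin

text \<open>For \<open>\<alpha> \<noteq> 0\<close> the kernel of \<open>\<alpha> g(x\<^sup>\<gamma>) + \<beta> x^(q^(kt))\<close> is the solution set of \<open>g(x\<^sup>\<gamma>) = c x^(q^(kt))\<close>.
  Both \<open>g\<close> and the map on the right are linear over the field \<open>F\<close> with \<open>q^t\<close> elements, so for
  \<open>c \<noteq> 0\<close> these are the fixed vectors of a map that is semilinear with respect to a generator of the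
  Galois group of \<open>F\<close>. Fixed vectors independent over the small field are independent over \<open>F\<close>, so
  the kernel has dimension at most \<open>t'\<close> and every nonzero codeword has rank at least \<open>n - t'\<close>. In
  particular the code has dimension \<open>2n\<close>, for which the Singleton-like bound gives \<open>d\<^sup>* = n - 1\<close>; the
  codeword with \<open>c = g(1)\<close> vanishes at \<open>1\<close>, so the minimum distance is at most \<open>n - 1\<close>.\<close>

section \<open>Finite fields\<close>

text \<open>Multiplication by a nonzero \<open>x\<close> permutes the nonzero elements, so it leaves
  their product unchanged.\<close>

lemma power_card_field:
  fixes x :: "'a::{field,finite}"
  shows "x ^ CARD('a) = x"
proof (cases "x = 0")
  case False
  have inj: "inj_on ((*) x) (- {0})"
    using False by (auto simp: inj_on_def)
  then have img: "(*) x ` (- {0}) = - {0}"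
    using False by (intro endo_inj_surj) auto
  have "prod id (- {0::'a}) = (\<Prod>y\<in>- {0}. x * y)"
    using prod.reindex[OF inj, of id] by (simp add: img comp_def)
  also have "\<dots> = x ^ card (- {0::'a}) * prod id (- {0::'a})"
    by (simp add: prod.distrib)
  finally have "x ^ card (- {0::'a}) = 1" by simp
  moreover have "CARD('a) = Suc (card (- {0::'a}))"
    by (simp add: Compl_eq_Diff_UNIV card.remove[symmetric])
  ultimately show ?thesis by simp
qed simp

text \<open>Since \<open>y ^ CARD('k) = y\<close> for every \<open>y\<close>, the inner terms of
  \<open>(x + 1) ^ CARD('k)\<close> sum to zero at every \<open>x\<close>. They form a polynomial of
  degree below \<open>CARD('k)\<close> with \<open>CARD('k)\<close> roots, hence the zero
  polynomial.\<close>

lemma of_nat_card_choose_eq_0: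
  assumes "0 < i" "i < CARD('k)"
  shows "of_nat (CARD('k) choose i) = (0::'k::{field,finite})"
proof -
  let ?q = "CARD('k)"
  define p :: "'k poly" where "p = (\<Sum>i\<in>{0<..<?q}. monom (of_nat (?q choose i)) i)"
  have q0: "0 < ?q" by simp
  have "poly p x = 0" for x
  proof -
    have "{..?q} = insert 0 (insert ?q {0<..<?q})" using q0 by auto
    then have "(x + 1) ^ ?q = 1 + (x ^ ?q + poly p x)"
      using q0 by (simp add: binomial_ring p_def poly_sum poly_monom)
    then show ?thesis by (simp add: power_card_field)
  qed
  moreover have "degree p < ?q"
    unfolding p_def by (rule degree_sum_less) (auto intro: le_less_trans[OF degree_monom_le])
  ultimately have "p = 0"
    by (intro poly_eqI_degree[where A = UNIV]) auto
  then have "coeff p i = 0" by simp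
  then show ?thesis using assms by (simp add: p_def coeff_sum)
qed

text \<open>The polynomial \<open>x ^ (Q ^ m) - x\<close> vanishes everywhere and factors as
  \<open>(x ^ Q - x) * H\<close> with \<open>H\<close> of degree at most \<open>Q ^ m - Q\<close>.
  The roots of \<open>H\<close> thus leave at least \<open>Q\<close> elements to the first factor.
  For \<open>Q = q ^ t\<close> this bounds the size of the intermediate field from below.\<close>

lemma card_power_eq_self_ge:
  assumes "CARD('a) = Q ^ m" "0 < m" "1 < Q"
  shows "Q \<le> card {x::'a::{field,finite}. x ^ Q = x}"
proof -
  define N where "N = Q - 1"
  have Q: "Q = Suc N" using assms by (simp add: N_def)
  have N0: "N > 0" using assms by (simp add: N_def)
  have "int Q - 1 dvd int Q ^ m - 1"
    using power_diff_1_eq[of "int Q" m] by simp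
  then have "int N dvd int (Q ^ m - 1)" using assms by (simp add: N_def of_nat_diff)
  then obtain r where r: "Q ^ m - 1 = N * r" unfolding int_dvd_int_iff by blast
  have Qm: "Q ^ m = Suc (N * r)" using r assms by (metis Suc_diff_1 zero_less_power less_trans zero_less_one)
  have r0: "r > 0" using Qm assms by (metis Suc_inject gr0I mult_0_right one_less_power less_irrefl One_nat_def)
  \<comment> \<open>The geometric sum in \<open>x ^ N\<close>, which is the cofactor of
    \<open>x ^ N - 1\<close> in \<open>x ^ (N * r) - 1\<close>.\<close>
  define H :: "'a poly" where "H = (\<Sum>i<r. monom 1 (N * i))"
  have split: "x ^ (Q ^ m) - x = (x ^ Q - x) * poly H x" for x :: 'a
  proof -
    have "x ^ (Q ^ m) - x = x * ((x ^ N) ^ r - 1)"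
      by (simp add: Qm power_mult algebra_simps)
    also have "\<dots> = x * ((x ^ N - 1) * (\<Sum>i<r. (x ^ N) ^ i))"
      by (simp only: power_diff_1_eq)
    also have "(\<Sum>i<r. (x ^ N) ^ i) = poly H x"
      by (simp add: H_def poly_sum poly_monom power_mult)
    also have "x * ((x ^ N - 1) * poly H x) = (x ^ Q - x) * poly H x"
      by (simp add: Q algebra_simps)
    finally show ?thesis .
  qed
  have "coeff H 0 = 1"
    using r0 N0 by (simp add: H_def coeff_sum if_distrib sum.delta cong: if_cong)
  then have H0: "H \<noteq> 0" by auto
  have degH: "degree H \<le> N * (r - 1)"
    unfolding H_def by (rule degree_sum_le) (auto intro!: order.trans[OF degree_monom_le] mult_le_mono)
  have "(UNIV::'a set) = {x. x ^ Q = x} \<union> {x. poly H x = 0}"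
    using split power_card_field[where 'a = 'a] assms(1) by auto
  then have "CARD('a) \<le> card {x::'a. x ^ Q = x} + card {x. poly H x = 0}"
    by (metis card_Un_le)
  moreover have "card {x. poly H x = 0} \<le> N * (r - 1)"
    using card_poly_roots_bound[OF H0] degH by simp
  moreover have "CARD('a) = Q + N * (r - 1)"
    using assms(1) Qm r0 by (cases r) (simp_all add: Q)
  ultimately show ?thesis by simp
qed

lemma power_eq_self_iterate:
  assumes "x ^ (Q::nat) = (x::'a::monoid_mult)"
  shows "x ^ (Q ^ m) = x"
  by (induction m) (simp_all add: assms power_mult)

text \<open>The two power maps are powers of the \<open>q\<close>-power map with coprime exponents
  \<open>j\<close> and \<open>t\<close>, so a Bezout relation recovers the \<open>q\<close>-power
  map itself.\<close>

lemma power_eq_self_coprime: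
  fixes x :: "'a::monoid_mult"
  assumes "x ^ (q ^ j) = x" "x ^ (q ^ t) = x" "coprime j t" "t \<noteq> 0"
  shows "x ^ q = x"
proof -
  obtain u v where uv: "t * u = j * v + 1"
    using bezout_add_strong_nat[of t j] assms(3,4)
    by (metis coprime_common_divisor_nat)
  have "x = x ^ (q ^ (t * u))"
    using power_eq_self_iterate[OF assms(2)] by (simp add: power_mult)
  also have "\<dots> = (x ^ ((q ^ j) ^ v)) ^ q"
    by (simp add: uv power_add mult.commute flip: power_mult)
  also have "\<dots> = x ^ q" using power_eq_self_iterate[OF assms(1)] by simp
  finally show ?thesis by simp
qed

section \<open>Finite extensions\<close>

lemma field_embedding_0: "field_embedding \<iota> \<Longrightarrow> \<iota> 0 = 0"
  unfolding field_embedding_def by (metis add_cancel_right_right)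

lemma field_embedding_inj: assumes "field_embedding \<iota>" shows "inj \<iota>"
proof (rule injI)
  fix x y assume eq: "\<iota> x = \<iota> y"
  have "\<iota> x = \<iota> (x - y) + \<iota> y"
    using assms unfolding field_embedding_def by (metis diff_add_cancel)
  then have "\<iota> (x - y) = 0" using eq by simp
  then have "\<iota> ((x - y) * inverse (x - y)) = 0"
    using assms unfolding field_embedding_def by simp
  then show "x = y"
    using assms unfolding field_embedding_def
    by (cases "x = y") auto
qed

lemma field_embedding_of_nat:
  "field_embedding \<iota> \<Longrightarrow> \<iota> (of_nat m) = of_nat m"
  by (induction m) (simp_all add: field_embedding_0, simp_all add: field_embedding_def)

lemma field_embedding_power:
  "field_embedding \<iota> \<Longrightarrow> \<iota> (x ^ m) = \<iota> x ^ m"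
  by (induction m) (simp_all add: field_embedding_def)

text \<open>The inner binomial coefficients vanish in \<open>'k\<close>, and \<open>\<iota>\<close>
  carries this over to \<open>'a\<close>; the general exponent follows by iteration.\<close>

lemma frobenius_add:
  fixes \<iota> :: "'k::{field,finite} \<Rightarrow> 'a::field"
  assumes "field_embedding \<iota>"
  shows "(x + y) ^ (CARD('k) ^ m) = x ^ (CARD('k) ^ m) + (y::'a) ^ (CARD('k) ^ m)"
proof (induction m)
  case (Suc m)
  let ?q = "CARD('k)"
  have *: "(x + y) ^ ?q = x ^ ?q + y ^ ?q" for x y :: 'a
  proof -
    have "{..?q} = insert 0 (insert ?q {0<..<?q})" by auto
    moreover have "of_nat (?q choose i) = (0::'a)" if "i \<in> {0<..<?q}" for i
      using that of_nat_card_choose_eq_0[of i] field_embedding_of_nat[OF assms]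
      by (metis field_embedding_0[OF assms] greaterThanLessThan_iff)
    ultimately show ?thesis by (simp add: binomial_ring)
  qed
  have "(x + y) ^ (?q ^ Suc m) = ((x + y) ^ (?q ^ m)) ^ ?q"
    by (simp add: mult.commute flip: power_mult)
  then show ?case by (simp add: Suc *) (simp add: mult.commute flip: power_mult)
qed simp

lemma frobenius_sum:
  fixes \<iota> :: "'k::{field,finite} \<Rightarrow> 'a::field"
  assumes "field_embedding \<iota>"
  shows "(\<Sum>i\<in>I. f i) ^ (CARD('k) ^ m) = (\<Sum>i\<in>I. (f i :: 'a) ^ (CARD('k) ^ m))"
  by (induction I rule: infinite_finite_induct)
    (simp_all add: frobenius_add[OF assms] power_0_left)

text \<open>The image of \<open>\<iota>\<close> already supplies as many roots of
  \<open>x ^ CARD('k) - x\<close> as its degree permits.\<close>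

lemma power_card_eq_self_iff:
  fixes \<iota> :: "'k::{field,finite} \<Rightarrow> 'a::field"
  assumes "field_embedding \<iota>"
  shows "x ^ CARD('k) = x \<longleftrightarrow> x \<in> range \<iota>"
proof -
  define p :: "'a poly" where "p = monom 1 CARD('k) - monom 1 1"
  have q1: "1 < CARD('k)"
    using card_mono[of UNIV "{0, 1::'k}"] by simp
  have "coeff p CARD('k) = 1" using q1 by (simp add: p_def)
  then have p0: "p \<noteq> 0" by auto
  have roots: "{x. poly p x = 0} = {x. x ^ CARD('k) = x}"
    by (auto simp: p_def poly_monom)
  have sub: "range \<iota> \<subseteq> {x. x ^ CARD('k) = x}"
    by (auto simp: power_card_field simp flip: field_embedding_power[OF assms])
  have "degree p \<le> CARD('k)"
    unfolding p_def using q1 by (intro degree_diff_le) (auto intro: order.trans[OF degree_monom_le])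
  then have "card {x. x ^ CARD('k) = (x::'a)} \<le> card (range \<iota>)"
    using card_poly_roots_bound[OF p0]
    by (simp add: roots card_image field_embedding_inj[OF assms])
  moreover have "finite {x. x ^ CARD('k) = (x::'a)}"
    using poly_roots_finite[OF p0] by (simp add: roots)
  ultimately have "range \<iota> = {x. x ^ CARD('k) = x}"
    using sub by (intro card_seteq) auto
  then show ?thesis by blast
qed

section \<open>Cardinalities of vector spaces\<close>

text \<open>Each vector of the span has exactly one coefficient family; extensional functions on
  \<open>B\<close> make these families countable.\<close>

lemma card_span_independent:
  fixes scale :: "'k::{field,finite} \<Rightarrow> 'v::ab_group_add \<Rightarrow> 'v"
  assumes "vector_space scale" "\<not> module.dependent scale B" "finite B"
  shows "card (module.span scale B) = CARD('k) ^ card B"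
proof -
  interpret vector_space scale by fact
  let ?f = "\<lambda>c. \<Sum>v\<in>B. scale (c v) v"
  have inj: "inj_on ?f (B \<rightarrow>\<^sub>E UNIV)"
  proof (rule inj_onI)
    fix c d assume cd: "c \<in> B \<rightarrow>\<^sub>E UNIV" "d \<in> B \<rightarrow>\<^sub>E UNIV" and eq: "?f c = ?f d"
    have "(\<Sum>v\<in>B. scale (c v - d v) v) = 0"
      using eq by (simp add: scale_left_diff_distrib sum_subtractf)
    then have "c v - d v = 0" if "v \<in> B" for v
      using independentD[OF assms(2,3) subset_refl, of "\<lambda>v. c v - d v"] that by simp
    then show "c = d" using cd by (intro PiE_ext) auto
  qed
  have "?f ` (B \<rightarrow>\<^sub>E UNIV) = span B"
  proof -
    have "?f c = ?f (restrict c B)" for c by (rule sum.cong) auto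
    then have "?f c \<in> ?f ` (B \<rightarrow>\<^sub>E UNIV)" for c
      by (intro image_eqI[of _ _ "restrict c B"]) auto
    then show ?thesis unfolding span_finite[OF assms(3)] by auto
  qed
  then have "card (span B) = card (B \<rightarrow>\<^sub>E (UNIV::'k set))"
    using card_image[OF inj] by simp
  then show ?thesis using assms(3) by (simp add: card_PiE)
qed

text \<open>Converts between dimension and cardinality, for row spaces, for kernels and for the code
  itself.\<close>

lemma card_subspace:
  fixes scale :: "'k::{field,finite} \<Rightarrow> 'v::{ab_group_add,finite} \<Rightarrow> 'v"
  assumes "vector_space scale" "module.subspace scale S"
  shows "card S = CARD('k) ^ vector_space.dim scale S"
proof -
  interpret vector_space scale by fact
  obtain B where B: "B \<subseteq> S" "independent B" "S \<subseteq> span B" "card B = dim S"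
    using basis_exists by blast
  then have "span B = S" using assms(2) by (metis span_minimal subset_antisym)
  then show ?thesis using card_span_independent[OF assms(1) B(2)] B(4) by simp
qed

text \<open>The multiple \<open>?w c\<close> of \<open>v\<close> has value \<open>c\<close> under
  \<open>\<phi>\<close>, so each vector of \<open>V\<close> splits uniquely into some
  \<open>?w c\<close> and an element of the kernel.\<close>

lemma card_kernel_functional:
  fixes \<phi> :: "('k::{field,finite}) ^ 'n \<Rightarrow> 'k"
  assumes sub: "vec.subspace V" and add: "\<And>x y. \<phi> (x + y) = \<phi> x + \<phi> y"
    and scale: "\<And>c x. \<phi> (c *s x) = c * \<phi> x"
    and v: "v \<in> V" "\<phi> v \<noteq> 0"
  shows "card V = CARD('k) * card {x\<in>V. \<phi> x = 0}"
proof -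
  let ?w = "\<lambda>c. (c / \<phi> v) *s v"
  have w: "?w c \<in> V" "\<phi> (?w c) = c" for c
    using v sub by (simp_all add: vec.subspace_scale scale)
  let ?K = "{x\<in>V. \<phi> x = 0}"
  have "bij_betw (\<lambda>(c, x). ?w c + x) (UNIV \<times> ?K) V"
  proof (rule bij_betw_byWitness[where f' = "\<lambda>x. (\<phi> x, x - ?w (\<phi> x))"], goal_cases)
    case 4
    have "\<phi> (x - ?w (\<phi> x)) = 0" for x
      using add[of "x - ?w (\<phi> x)" "?w (\<phi> x)"] w(2)[of "\<phi> x"] by simp
    then show ?case using w(1) sub by (auto intro: vec.subspace_diff)
  qed (use w sub in \<open>auto simp: add intro: vec.subspace_add\<close>)
  from bij_betw_same_card[OF this] show ?thesis by simp
qed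

text \<open>The library identifies row and column rank only over the reals, so rank-nullity is obtained
  by counting the pairs of a vector of the row space and a vector orthogonal to it twice.\<close>

lemma card_null_space:
  fixes A :: "'k::{field,finite} ^ 'n ^ 'm"
  shows "card {x. A *v x = 0} * CARD('k) ^ rank A = CARD('k) ^ CARD('n)"
proof -
  let ?q = "CARD('k)" and ?R = "vec.span (rows A)" and ?N = "{x. A *v x = 0}"
  define ip :: "'k ^ 'n \<Rightarrow> 'k ^ 'n \<Rightarrow> 'k" where "ip v x = (\<Sum>i\<in>UNIV. v $ i * x $ i)" for v x
  have add: "ip v (x + y) = ip v x + ip v y" "ip (x + y) v = ip x v + ip y v"
    and sc: "ip v (c *s x) = c * ip v x" "ip (c *s x) v = c * ip x v" for v x y c
    by (simp_all add: ip_def algebra_simps sum.distrib sum_distrib_left)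
  have subR: "vec.subspace ?R" by (rule vec.subspace_span)
  have cardR: "card ?R = ?q ^ rank A"
    using card_subspace[OF vec.vector_space_axioms subR] by (simp add: row_rank_def_gen)
  \<comment> \<open>The null space is the orthogonal complement of the row space.\<close>
  have N: "x \<in> ?N \<longleftrightarrow> (\<forall>v\<in>?R. ip v x = 0)" for x
  proof
    assume "x \<in> ?N"
    then have r: "ip v x = 0" if "v \<in> rows A" for v
      using that by (auto simp: rows_def row_def ip_def vec_eq_iff matrix_vector_mult_def)
    have "vec.subspace {v. ip v x = 0}"
      by (auto simp: vec.subspace_def add sc) (simp add: ip_def)
    then have "?R \<subseteq> {v. ip v x = 0}"
      using r by (intro vec.span_minimal) auto
    then show "\<forall>v\<in>?R. ip v x = 0" by auto
  next
    assume "\<forall>v\<in>?R. ip v x = 0"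
    then have "ip (row i A) x = 0" for i
      by (auto simp: rows_def intro!: vec.span_base)
    then show "x \<in> ?N" by (simp add: row_def ip_def vec_eq_iff matrix_vector_mult_def)
  qed
  have zero: "ip 0 x = 0" for x by (simp add: ip_def)
  have U: "vec.subspace (UNIV :: ('k ^ 'n) set)" by simp
  have card1: "?q * card {x. ip v x = 0} = ?q ^ CARD('n)" if "v \<noteq> 0" for v
  proof -
    obtain i where "v $ i \<noteq> 0" using \<open>v \<noteq> 0\<close> by (auto simp: vec_eq_iff)
    then have "ip v (axis i 1) \<noteq> 0"
      by (simp add: ip_def axis_def if_distrib cong: if_cong)
    from card_kernel_functional[where \<phi> = "ip v", OF U add(1) sc(1) UNIV_I this] show ?thesis by simp
  qed
  have card2: "?q * card {v\<in>?R. ip v x = 0} = card ?R" if x: "x \<notin> ?N" for x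
  proof -
    obtain v where "v \<in> ?R" "ip v x \<noteq> 0" using x N by blast
    from card_kernel_functional[where \<phi> = "\<lambda>v. ip v x", OF subR add(2) sc(2) this] show ?thesis by simp
  qed
  \<comment> \<open>The double count of orthogonal pairs. The factor \<open>?q\<close> spares a
    division: each nonzero \<open>v\<close>, and each \<open>x\<close> outside \<open>?N\<close>, is
    orthogonal to a fraction \<open>1 / ?q\<close> of the other side.\<close>
  have "?q * (\<Sum>v\<in>?R. card {x. ip v x = 0}) = ?q * (\<Sum>x\<in>UNIV. card {v\<in>?R. ip v x = 0})"
    using sum.swap_restrict[of ?R UNIV "\<lambda>_ _. 1::nat" "\<lambda>v x. ip v x = 0"] by simp
  moreover have "?q * (\<Sum>v\<in>?R. card {x. ip v x = 0}) = (\<Sum>v\<in>?R. ?q * card {x. ip v x = 0})"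
    by (rule sum_distrib_left)
  moreover have "\<dots> = ?q * ?q ^ CARD('n) + (card ?R - 1) * ?q ^ CARD('n)"
    by (simp add: sum.remove[where x = 0 and A = ?R] vec.span_zero card1 zero card_Diff_singleton)
  moreover have "?q * (\<Sum>x\<in>UNIV. card {v\<in>?R. ip v x = 0}) = (\<Sum>x\<in>UNIV. ?q * card {v\<in>?R. ip v x = 0})"
    by (rule sum_distrib_left)
  moreover have "\<dots> = (\<Sum>x\<in>?N. ?q * card {v\<in>?R. ip v x = 0}) + (\<Sum>x\<in>- ?N. ?q * card {v\<in>?R. ip v x = 0})"
    by (subst sum.union_disjoint[symmetric]) (auto intro: sum.cong)
  moreover have "(\<Sum>x\<in>?N. ?q * card {v\<in>?R. ip v x = 0}) = card ?N * (?q * card ?R)"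
  proof -
    have "{v\<in>?R. ip v x = 0} = ?R" if "x \<in> ?N" for x using N that by blast
    then show ?thesis by simp
  qed
  moreover have "(\<Sum>x\<in>- ?N. ?q * card {v\<in>?R. ip v x = 0}) = (?q ^ CARD('n) - card ?N) * card ?R"
    by (simp add: card2 Compl_eq_Diff_UNIV card_Diff_subset)
  ultimately have eq: "?q * ?q ^ CARD('n) + (card ?R - 1) * ?q ^ CARD('n)
      = card ?N * (?q * card ?R) + (?q ^ CARD('n) - card ?N) * card ?R"
    by simp
  \<comment> \<open>The substitutions for \<open>?q ^ CARD('n)\<close>, \<open>card ?R\<close> and
    \<open>?q\<close> remove truncated subtraction; the common factor \<open>p = ?q - 1\<close> then
    cancels.\<close>
  have "card ?N \<le> ?q ^ CARD('n)"
    using card_mono[of UNIV ?N] by simp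
  then obtain d where d: "?q ^ CARD('n) = card ?N + d" using le_Suc_ex by blast
  obtain r where r: "card ?R = Suc r" by (cases "card ?R") (auto simp: cardR)
  have "1 < ?q" using card_mono[of UNIV "{0, 1::'k}"] by simp
  then obtain p where p: "?q = Suc p" "p > 0" by (cases ?q) simp_all
  have "p * (card ?N + d) = p * (card ?N * Suc r)"
    using eq unfolding d r unfolding p(1) by (simp add: algebra_simps)
  then have "?q ^ CARD('n) = card ?N * card ?R" using d r p by simp
  then show ?thesis by (simp add: cardR)
qed

section \<open>Matrices of linear maps\<close>

definition ext_linear :: "('k::field \<Rightarrow> 'a::field) \<Rightarrow> ('a \<Rightarrow> 'a) \<Rightarrow> bool" where
  "ext_linear \<iota> f \<longleftrightarrow> (\<forall>x y. f (x + y) = f x + f y) \<and> (\<forall>c x. f (\<iota> c * x) = \<iota> c * f x)"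

lemma ext_linear_sum:
  assumes "ext_linear \<iota> f"
  shows "f (\<Sum>i\<in>I. \<iota> (c i) * x i) = (\<Sum>i\<in>I. \<iota> (c i) * f (x i))"
proof -
  have "f 0 = 0"
    using assms unfolding ext_linear_def by (intro additive.zero additive.intro) blast
  then show ?thesis
    using assms by (induction I rule: infinite_finite_induct) (auto simp: ext_linear_def)
qed

lemma ext_basis_sum_representation:
  fixes b :: "'n::finite \<Rightarrow> 'a::field"
  assumes "field_embedding \<iota>" "is_ext_basis \<iota> b"
  shows "(\<Sum>i\<in>UNIV. \<iota> (module.representation (ext_scale \<iota>) (range b) x (b i)) * b i) = x"
proof -
  interpret vector_space "ext_scale \<iota>" by (rule vector_space_ext_scale) fact
  have b: "inj b" "independent (range b)" "span (range b) = UNIV"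
    using assms(2) by (simp_all add: is_ext_basis_def)
  have "(\<Sum>v\<in>range b. ext_scale \<iota> (representation (range b) x v) v) = x"
    using b by (intro sum_representation_eq) auto
  then show ?thesis by (simp add: sum.reindex b(1) ext_scale_def)
qed

lemma ext_basis_bij:
  fixes b :: "'n::finite \<Rightarrow> 'a::field"
  assumes "field_embedding \<iota>" "is_ext_basis \<iota> b"
  shows "bij (\<lambda>v :: 'k::field ^ 'n. \<Sum>i\<in>UNIV. \<iota> (v $ i) * b i)"
proof (rule bijI)
  interpret vector_space "ext_scale \<iota>" by (rule vector_space_ext_scale) fact
  have b: "inj b" "independent (range b)"
    using assms(2) by (simp_all add: is_ext_basis_def)
  show "inj (\<lambda>v :: 'k ^ 'n. \<Sum>i\<in>UNIV. \<iota> (v $ i) * b i)"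
  proof (rule injI)
    fix v w :: "'k ^ 'n"
    assume eq: "(\<Sum>i\<in>UNIV. \<iota> (v $ i) * b i) = (\<Sum>i\<in>UNIV. \<iota> (w $ i) * b i)"
    \<comment> \<open>Independence speaks of coefficients attached to basis vectors, so
      \<open>inv b\<close> transfers them from the indices.\<close>
    let ?u = "\<lambda>x. v $ inv b x - w $ inv b x"
    have diff: "\<iota> (c - d) = \<iota> c - \<iota> d" for c d
      using assms(1) unfolding field_embedding_def by (metis add_diff_cancel_right' diff_add_cancel)
    have "(\<Sum>x\<in>range b. ext_scale \<iota> (?u x) x) = 0"
      using eq by (simp add: sum.reindex b(1) ext_scale_def diff left_diff_distrib sum_subtractf)
    then have "?u (b i) = 0" for i
      using independentD[OF b(2) _ subset_refl, of ?u] by simp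
    then show "v = w" by (simp add: vec_eq_iff b(1))
  qed
  show "surj (\<lambda>v :: 'k ^ 'n. \<Sum>i\<in>UNIV. \<iota> (v $ i) * b i)"
  proof (rule surjI)
    fix x
    show "(\<Sum>i\<in>UNIV. \<iota> ((\<chi> i. representation (range b) x (b i)) $ i) * b i) = x"
      using ext_basis_sum_representation[OF assms] by simp
  qed
qed

text \<open>Expanding each \<open>f (b j)\<close> in the basis and swapping the two sums shows that
  the matrix acts on coordinates as \<open>f\<close> does on field elements.\<close>

lemma matrix_of_map_mult:
  fixes b :: "'n::finite \<Rightarrow> 'a::field" and v :: "'k::field ^ 'n"
  assumes "field_embedding \<iota>" "is_ext_basis \<iota> b" "ext_linear \<iota> f"
  shows "(\<Sum>i\<in>UNIV. \<iota> ((matrix_of_map \<iota> b f *v v) $ i) * b i) = f (\<Sum>j\<in>UNIV. \<iota> (v $ j) * b j)"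
proof -
  let ?r = "\<lambda>i j. module.representation (ext_scale \<iota>) (range b) (f (b j)) (b i)"
  have hom: "\<iota> (\<Sum>j\<in>J. h j) = (\<Sum>j\<in>J. \<iota> (h j))" "\<iota> (c * d) = \<iota> c * \<iota> d"
    for h and J :: "'n set" and c d
    using assms(1) field_embedding_0[OF assms(1)]
    by (induction J rule: infinite_finite_induct) (auto simp: field_embedding_def)
  have "(\<Sum>i\<in>UNIV. \<iota> ((matrix_of_map \<iota> b f *v v) $ i) * b i)
      = (\<Sum>i\<in>UNIV. \<Sum>j\<in>UNIV. \<iota> (v $ j) * (\<iota> (?r i j) * b i))"
    by (simp add: matrix_of_map_def matrix_vector_mult_def hom sum_distrib_right sum_distrib_left mult_ac)
  also have "\<dots> = (\<Sum>j\<in>UNIV. \<iota> (v $ j) * (\<Sum>i\<in>UNIV. \<iota> (?r i j) * b i))"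
    by (subst sum.swap) (simp add: sum_distrib_left)
  also have "\<dots> = (\<Sum>j\<in>UNIV. \<iota> (v $ j) * f (b j))"
    by (simp only: ext_basis_sum_representation[OF assms(1,2)])
  also have "\<dots> = f (\<Sum>j\<in>UNIV. \<iota> (v $ j) * b j)"
    by (simp only: ext_linear_sum[OF assms(3)])
  finally show ?thesis .
qed

text \<open>The coordinate bijection \<open>\<theta>\<close> carries the null space of the matrix
  onto the kernel of \<open>f\<close>.\<close>

lemma card_kernel_rank:
  fixes \<iota> :: "'k::{field,finite} \<Rightarrow> 'a::field" and b :: "'n::finite \<Rightarrow> 'a"
  assumes "field_embedding \<iota>" "is_ext_basis \<iota> b" "ext_linear \<iota> f"
  shows "card {x. f x = 0} * CARD('k) ^ rank (matrix_of_map \<iota> b f) = CARD('k) ^ CARD('n)"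
proof -
  define \<theta> :: "'k ^ 'n \<Rightarrow> 'a" where "\<theta> v = (\<Sum>i\<in>UNIV. \<iota> (v $ i) * b i)" for v
  have bij: "bij \<theta>"
    unfolding \<theta>_def using ext_basis_bij[OF assms(1,2)] .
  have "\<theta> 0 = 0" by (simp add: \<theta>_def field_embedding_0[OF assms(1)])
  moreover have "\<theta> (matrix_of_map \<iota> b f *v v) = f (\<theta> v)" for v
    unfolding \<theta>_def by (rule matrix_of_map_mult[OF assms])
  ultimately have "matrix_of_map \<iota> b f *v v = 0 \<longleftrightarrow> f (\<theta> v) = 0" for v
    using bij by (metis bij_is_inj inj_eq)
  then have "\<theta> ` {v. matrix_of_map \<iota> b f *v v = 0} = {x. f x = 0}"
    using bij_is_surj[OF bij] by auto
  then have "card {v. matrix_of_map \<iota> b f *v v = 0} = card {x. f x = 0}"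
    using bij by (metis bij_is_inj card_image inj_on_subset subset_UNIV)
  then show ?thesis using card_null_space[of "matrix_of_map \<iota> b f"] by simp
qed

lemma matrix_of_map_combination:
  fixes b :: "'n::finite \<Rightarrow> 'a::field"
  assumes "field_embedding \<iota>" "is_ext_basis \<iota> b"
  shows "matrix_of_map \<iota> b (\<lambda>x. f x + h x) = matrix_of_map \<iota> b f + matrix_of_map \<iota> b h"
    and "matrix_of_map \<iota> b (\<lambda>x. \<iota> c * f x) = mat_smult c (matrix_of_map \<iota> b f)"
proof -
  interpret vector_space "ext_scale \<iota>" by (rule vector_space_ext_scale) fact
  have b: "independent (range b)" "span (range b) = UNIV"
    using assms(2) by (simp_all add: is_ext_basis_def)
  show "matrix_of_map \<iota> b (\<lambda>x. f x + h x) = matrix_of_map \<iota> b f + matrix_of_map \<iota> b h"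
    by (simp add: matrix_of_map_def vec_eq_iff representation_add b)
  have "representation (range b) (\<iota> c * x) = (\<lambda>v. c * representation (range b) x v)" for x
    using representation_scale[of "range b" x c] b by (simp add: ext_scale_def)
  then show "matrix_of_map \<iota> b (\<lambda>x. \<iota> c * f x) = mat_smult c (matrix_of_map \<iota> b f)"
    by (simp add: matrix_of_map_def mat_smult_def vec_eq_iff)
qed

section \<open>Semilinear maps\<close>

text \<open>Vectors fixed by a semilinear map that are independent over the fixed field of its
  automorphism are independent over the whole field: a dependency with one coefficient normalised
  to \<open>1\<close> stays a dependency when the automorphism is applied to its coefficients, and subtracting
  the two gives a shorter one.\<close>

lemma semilinear_fixed_independent:
  fixes \<iota> :: "'k::field \<Rightarrow> 'a::field" and F :: "'a set"
  assumes emb: "field_embedding \<iota>"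
    and F: "\<And>x y. x \<in> F \<Longrightarrow> y \<in> F \<Longrightarrow> x / y \<in> F" "\<And>x y. x \<in> F \<Longrightarrow> y \<in> F \<Longrightarrow> x - y \<in> F"
    and \<sigma>: "\<And>x. x \<in> F \<Longrightarrow> \<sigma> x \<in> F" "\<sigma> 1 = 1"
    and fixed: "\<And>x. x \<in> F \<Longrightarrow> \<sigma> x = x \<Longrightarrow> x \<in> range \<iota>"
    and rel: "\<And>C c. C \<subseteq> S \<Longrightarrow> c ` C \<subseteq> F \<Longrightarrow> (\<Sum>x\<in>C. c x * x) = 0 \<Longrightarrow> (\<Sum>x\<in>C. \<sigma> (c x) * x) = 0"
    and B: "finite B" "B \<subseteq> S" "\<not> module.dependent (ext_scale \<iota>) B"
    and c: "c ` B \<subseteq> F" "(\<Sum>x\<in>B. c x * x) = 0"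
  shows "\<forall>x\<in>B. c x = 0"
  using B c
proof (induction B arbitrary: c rule: finite_induct)
  case (insert b B)
  interpret vector_space "ext_scale \<iota>" by (rule vector_space_ext_scale) fact
  have indep: "independent (insert b B)" "independent B"
    using insert.prems(2) independent_mono by auto
  have IH: "\<forall>x\<in>B. d x = 0" if "d ` B \<subseteq> F" "(\<Sum>x\<in>B. d x * x) = 0" for d
    using insert.IH[OF _ indep(2) that] insert.prems(1) by simp
  have "c b = 0"
  proof (rule ccontr)
    assume cb: "c b \<noteq> 0"
    define d where "d x = c x / c b" for x
    define e where "e x = inv \<iota> (d x)" for x
    have dF: "d ` insert b B \<subseteq> F"
      unfolding d_def using insert.prems(3) by (intro image_subsetI F(1)) auto
    have d1: "d b = 1" using cb by (simp add: d_def)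
    have d0: "(\<Sum>x\<in>insert b B. d x * x) = 0"
      using insert.prems(4) by (simp add: d_def flip: sum_divide_distrib del: sum.insert)
    have "(\<Sum>x\<in>insert b B. \<sigma> (d x) * x) = 0"
      using rel[OF insert.prems(1) dF d0] .
    then have "(\<Sum>x\<in>B. (\<sigma> (d x) - d x) * x) = 0"
      using d0 insert.hyps by (simp add: d1 \<sigma>(2) left_diff_distrib sum_subtractf) (metis add_left_cancel)
    then have "\<forall>x\<in>B. \<sigma> (d x) - d x = 0"
      using dF F(2) \<sigma>(1) by (intro IH) auto
    \<comment> \<open>Every coefficient is now fixed by \<open>\<sigma>\<close>, so the relation
      lives over the small field, where independence contradicts \<open>d b = 1\<close>.\<close>
    then have "\<forall>x\<in>insert b B. d x \<in> range \<iota>"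
      using fixed dF d1 \<sigma>(2) by auto
    then have e: "\<forall>x\<in>insert b B. d x = \<iota> (e x)"
      by (simp add: e_def f_inv_into_f)
    have "(\<Sum>x\<in>insert b B. ext_scale \<iota> (e x) x) = (\<Sum>x\<in>insert b B. d x * x)"
      by (rule sum.cong) (use e in \<open>auto simp: ext_scale_def\<close>)
    then have "e b = 0"
      using independentD[OF indep(1) _ subset_refl, of e b] insert.hyps(1) d0 by simp
    then show False using e d1 field_embedding_0[OF emb] by auto
  qed
  then have "\<forall>x\<in>B. c x = 0"
    using insert.prems(3,4) insert.hyps by (intro IH) auto
  then show ?case using \<open>c b = 0\<close> by simp
qed simp

text \<open>For \<open>c \<noteq> 0\<close>, a basis \<open>B\<close> of the kernel over the small
  field stays independent over \<open>?F\<close>, which has at least \<open>q ^ t\<close> elements.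
  Distinct coefficient families in \<open>?F\<close> give distinct sums in a field of
  \<open>q ^ (t * t')\<close> elements, so \<open>card B \<le> t'\<close>. For \<open>c = 0\<close>,
  injectivity of \<open>g\<close> leaves only zero.\<close>

lemma card_semilinear_kernel:
  fixes \<iota> :: "'k::{field,finite} \<Rightarrow> 'a::{field,finite}"
    and g :: "'a \<Rightarrow> 'a"
  defines "q \<equiv> CARD('k)"
  assumes emb: "field_embedding \<iota>" and card: "CARD('a) = q ^ (t * t')"
    and t: "t > 0" "t' > 0" and cop: "coprime j t"
    and add: "\<And>x y. g (x + y) = g x + g y"
    and hom: "\<And>c x. c ^ (q ^ t) = c \<Longrightarrow> g (c * x) = c * g x"
    and inj: "\<And>x. g x = 0 \<Longrightarrow> x = 0"
  shows "card {x. g (x ^ (q ^ j)) = c * x ^ (q ^ (k * t))} \<le> q ^ t'"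
proof (cases "c = 0")
  case True
  have q: "q > 0" by (simp add: q_def)
  have g0: "g 0 = 0" by (intro additive.zero additive.intro add)
  have "{x. g (x ^ (q ^ j)) = c * x ^ (q ^ (k * t))} \<subseteq> {0}"
    using True by (auto dest!: inj)
  then have "card {x. g (x ^ (q ^ j)) = c * x ^ (q ^ (k * t))} \<le> 1"
    using card_mono[of "{0}"] by simp
  also have "\<dots> \<le> q ^ t'" using q by simp
  finally show ?thesis .
next
  case False
  let ?K = "{x. g (x ^ (q ^ j)) = c * x ^ (q ^ (k * t))}"
  let ?F = "{x :: 'a. x ^ (q ^ t) = x}"
  interpret vector_space "ext_scale \<iota>" by (rule vector_space_ext_scale) fact
  have q1: "1 < q" using card_mono[of UNIV "{0, 1::'k}"] by (simp add: q_def)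
  have fadd: "(x + y) ^ (q ^ m) = x ^ (q ^ m) + y ^ (q ^ m)" for x y :: 'a and m
    unfolding q_def by (rule frobenius_add[OF emb])
  have fsum: "(\<Sum>i\<in>I. h i) ^ (q ^ m) = (\<Sum>i\<in>I. h i ^ (q ^ m))" for h :: "'a \<Rightarrow> 'a" and I m
    unfolding q_def by (rule frobenius_sum[OF emb])
  have fdiff: "(x - y) ^ (q ^ m) = x ^ (q ^ m) - y ^ (q ^ m)" for x y :: 'a and m
    using fadd[of "x - y" y m] by simp
  have g0: "g 0 = 0" by (intro additive.zero additive.intro add)
  have gsum: "g (\<Sum>i\<in>I. h i) = (\<Sum>i\<in>I. g (h i))" for h :: "'a \<Rightarrow> 'a" and I
    by (induction I rule: infinite_finite_induct) (simp_all add: g0 add)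
  have \<iota>q: "\<iota> d ^ q = \<iota> d" for d
    unfolding q_def using power_card_eq_self_iff[OF emb] by blast
  have \<iota>qm: "\<iota> d ^ (q ^ m) = \<iota> d" for d m
    by (rule power_eq_self_iterate[OF \<iota>q])
  have subK: "subspace ?K"
    using q1 by (auto simp: subspace_def ext_scale_def g0 fadd add power_mult_distrib \<iota>qm hom
        distrib_left mult.left_commute power_0_left)
  then have cardK: "card ?K = q ^ dim ?K"
    unfolding q_def by (rule card_subspace[OF vector_space_axioms])
  obtain B where B: "B \<subseteq> ?K" "independent B" "?K \<subseteq> span B" "card B = dim ?K"
    by (rule basis_exists[of ?K])
  \<comment> \<open>The power \<open>q ^ (k * t)\<close> fixes the coefficients, which lie in
    \<open>?F\<close>, and the kernel equation turns \<open>c * x ^ (q ^ (k * t))\<close> into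
    \<open>g (x ^ (q ^ j))\<close>. So \<open>c\<close> times this power of the new sum is
    \<open>g\<close> of the \<open>q ^ j\<close>-th power of the old one, hence zero.\<close>
  have rel: "(\<Sum>x\<in>C. d x ^ (q ^ j) * x) = 0"
    if C: "C \<subseteq> ?K" and d: "d ` C \<subseteq> ?F" and sum: "(\<Sum>x\<in>C. d x * x) = 0" for C d
  proof -
    have dj: "(d x ^ (q ^ j)) ^ (q ^ t) = d x ^ (q ^ j)" if "x \<in> C" for x
    proof -
      have "(d x ^ (q ^ j)) ^ (q ^ t) = (d x ^ (q ^ t)) ^ (q ^ j)"
        by (simp add: mult.commute flip: power_mult)
      then show ?thesis using d that by auto
    qed
    have dk: "(d x ^ (q ^ j)) ^ (q ^ (k * t)) = d x ^ (q ^ j)" if "x \<in> C" for x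
      using power_eq_self_iterate[OF dj[OF that], of k] by (simp add: mult.commute flip: power_mult)
    have "c * (\<Sum>x\<in>C. d x ^ (q ^ j) * x) ^ (q ^ (k * t))
        = (\<Sum>x\<in>C. d x ^ (q ^ j) * (c * x ^ (q ^ (k * t))))"
      by (simp add: fsum power_mult_distrib dk sum_distrib_left mult.left_commute)
    also have "\<dots> = (\<Sum>x\<in>C. g (d x ^ (q ^ j) * x ^ (q ^ j)))"
      using C by (intro sum.cong) (auto simp: hom dj)
    also have "\<dots> = g ((\<Sum>x\<in>C. d x * x) ^ (q ^ j))"
      by (simp add: gsum fsum power_mult_distrib)
    also have "\<dots> = 0" using q1 by (simp add: sum g0 power_0_left)
    finally show ?thesis using False by simp
  qed
  have indep: "\<forall>x\<in>B. d x = 0" if "d ` B \<subseteq> ?F" "(\<Sum>x\<in>B. d x * x) = 0" for d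
  proof (rule semilinear_fixed_independent[OF emb, where F = ?F and \<sigma> = "\<lambda>x. x ^ (q ^ j)"])
    \<comment> \<open>Coprimality of \<open>j\<close> and \<open>t\<close> makes the small field the
      whole fixed field of the automorphism of \<open>?F\<close>.\<close>
    show "x \<in> range \<iota>" if "x \<in> ?F" "x ^ (q ^ j) = x" for x
      using power_eq_self_coprime[OF that(2) _ cop] that(1) t
      unfolding power_card_eq_self_iff[OF emb, symmetric] by (simp add: q_def)
    show "x ^ (q ^ j) \<in> ?F" if "x \<in> ?F" for x
    proof -
      have "(x ^ (q ^ j)) ^ (q ^ t) = (x ^ (q ^ t)) ^ (q ^ j)"
        by (simp add: mult.commute flip: power_mult)
      then show ?thesis using that by simp
    qed
  qed (use rel B that in \<open>auto simp: power_divide fdiff\<close>)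
  have "inj_on (\<lambda>d. \<Sum>x\<in>B. d x * x) (B \<rightarrow>\<^sub>E ?F)"
  proof (rule inj_onI)
    fix d e assume de: "d \<in> B \<rightarrow>\<^sub>E ?F" "e \<in> B \<rightarrow>\<^sub>E ?F"
      and eq: "(\<Sum>x\<in>B. d x * x) = (\<Sum>x\<in>B. e x * x)"
    have "\<forall>x\<in>B. d x - e x = 0"
      using de eq by (intro indep) (auto simp: fdiff left_diff_distrib sum_subtractf PiE_iff)
    then show "d = e" using de by (intro PiE_ext) auto
  qed
  then have "card (B \<rightarrow>\<^sub>E ?F) \<le> CARD('a)"
    by (rule card_inj_on_le) auto
  then have "card ?F ^ card B \<le> q ^ (t * t')"
    by (simp add: card_PiE card)
  moreover have "q ^ t \<le> card ?F"
    using card t one_less_power[OF q1 t(1)]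
    by (intro card_power_eq_self_ge[where m = t']) (simp_all add: power_mult)
  then have "(q ^ t) ^ card B \<le> card ?F ^ card B" by (rule power_mono) simp
  ultimately have "q ^ (t * card B) \<le> q ^ (t * t')" by (simp add: power_mult)
  then have "card B \<le> t'" using q1 t by simp
  then show ?thesis using q1 by (simp add: cardK flip: B(4))
qed

section \<open>The code\<close>

text \<open>Cancelling the positive factor \<open>n\<close> in
  \<open>2 * n \<le> n * (n - d + 1)\<close> leaves \<open>d \<le> n - 1\<close>, so the admissible
  distances form an initial segment.\<close>

lemma max_distance_dim_double:
  fixes C :: "('k::field ^ 'n ^ 'n) set"
  assumes "mat_vs.dim C = 2 * CARD('n)"
  shows "max_distance C = CARD('n) - 1"
proof -
  let ?n = "CARD('n)"
  have "singleton_like_bound ?n ?n (2 * ?n) d \<longleftrightarrow> d \<le> ?n - 1" for d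
  proof -
    have "singleton_like_bound ?n ?n (2 * ?n) d \<longleftrightarrow> int ?n * 2 \<le> int ?n * (int ?n - int d + 1)"
      by (simp add: singleton_like_bound_def mult.commute)
    also have "\<dots> \<longleftrightarrow> 2 \<le> int ?n - int d + 1" by (subst mult_le_cancel_left_pos) simp_all
    also have "\<dots> \<longleftrightarrow> d \<le> ?n - 1" using zero_less_card_finite[where 'a = 'n] by linarith
    finally show ?thesis .
  qed
  then have "max_distance C = Max {..?n - 1}"
    by (simp add: max_distance_def assms atMost_def)
  then show ?thesis by (simp add: Max_eq_iff)
qed

theorem theorem3p2:
  fixes q n t t' j k :: nat
    and \<iota> :: "'k::{field,finite} \<Rightarrow> 'a::{field,finite}"
    and b :: "'n::finite \<Rightarrow> 'a"
    and a :: "nat \<Rightarrow> 'a"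
  assumes "CARD('k) = q" and "CARD('a) = q ^ n" and "field_embedding \<iota>"
    and "CARD('n) = n" and "is_ext_basis \<iota> b"
    and "n = t * t'" and "t \<ge> 2" and "t' \<ge> 2"
    and "bij (g_poly q t t' a)"
    and "coprime j t"
  shows "\<exists>s. real s \<le> real n / real t - 1 \<and>
    almost_MRD s (matrix_of_map \<iota> b `
      span2 (\<lambda>x. g_poly q t t' a (x ^ (q ^ j))) (\<lambda>x. x ^ (q ^ (k * t))))"
proof -
  let ?g = "g_poly q t t' a" and ?h = "\<lambda>x :: 'a. x ^ (q ^ (k * t))"
  \<comment> \<open>Codewords are indexed by their coefficient pairs, on which linear operations and
    the size of the code can be computed.\<close>
  define f where "f \<alpha> \<beta> = (\<lambda>x. \<alpha> * ?g (x ^ (q ^ j)) + \<beta> * ?h x)" for \<alpha> \<beta>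
  define M where "M \<alpha> \<beta> = matrix_of_map \<iota> b (f \<alpha> \<beta>)" for \<alpha> \<beta>
  define C where "C = (\<lambda>(\<alpha>, \<beta>). M \<alpha> \<beta>) ` UNIV"
  have C: "matrix_of_map \<iota> b ` span2 (\<lambda>x. ?g (x ^ (q ^ j))) ?h = C"
    by (auto simp: C_def M_def f_def span2_def)
  have emb: "field_embedding \<iota>" and q: "q = CARD('k)" using assms by simp_all
  have q1: "1 < q" using card_mono[of UNIV "{0, 1::'k}"] by (simp add: q)
  have n: "t' < n" "0 < n" using assms(6-8) by auto
  have fadd: "(x + y) ^ (q ^ m) = x ^ (q ^ m) + y ^ (q ^ m)" for x y :: 'a and m
    unfolding q by (rule frobenius_add[OF emb])
  have \<iota>q: "\<iota> d ^ (q ^ m) = \<iota> d" for d m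
    using power_card_eq_self_iff[OF emb] by (intro power_eq_self_iterate) (auto simp: q)
  have gadd: "?g (x + y) = ?g x + ?g y" for x y
    by (simp add: g_poly_def fadd distrib_left sum.distrib)
  \<comment> \<open>All exponents in \<open>?g\<close> are powers of \<open>q ^ t\<close>, so they
    fix such a \<open>c\<close>.\<close>
  have ghom: "?g (c * x) = c * ?g x" if "c ^ (q ^ t) = c" for c x
  proof -
    have "c ^ (q ^ (i * t)) = c" for i
      using power_eq_self_iterate[OF that, of i] by (simp add: mult.commute flip: power_mult)
    then show ?thesis
      by (simp add: g_poly_def power_mult_distrib sum_distrib_left mult.left_commute)
  qed
  have g0: "?g 0 = 0" by (intro additive.zero additive.intro gadd)
  have ginj: "x = 0" if "?g x = 0" for x
    using that g0 \<open>bij ?g\<close> by (metis bij_is_inj injD)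
  have lin: "ext_linear \<iota> (f \<alpha> \<beta>)" for \<alpha> \<beta>
    unfolding ext_linear_def f_def
    by (auto simp: fadd gadd power_mult_distrib \<iota>q ghom algebra_simps)
  have ker: "card {x. f \<alpha> \<beta> x = 0} \<le> q ^ t'" if "(\<alpha>, \<beta>) \<noteq> (0, 0)" for \<alpha> \<beta>
  proof (cases "\<alpha> = 0")
    case True
    then have "{x. f \<alpha> \<beta> x = 0} \<subseteq> {0}" using that by (auto simp: f_def)
    then have "card {x. f \<alpha> \<beta> x = 0} \<le> 1" using card_mono[of "{0}"] by simp
    also have "\<dots> \<le> q ^ t'" using q1 by simp
    finally show ?thesis .
  next
    case False
    \<comment> \<open>Dividing by \<open>\<alpha>\<close> brings the kernel into semilinear form
      with constant \<open>- \<beta> / \<alpha>\<close>.\<close>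
    have "{x. f \<alpha> \<beta> x = 0} = {x. ?g (x ^ (q ^ j)) = (- \<beta> / \<alpha>) * ?h x}"
      using False by (auto simp: f_def field_simps add_eq_0_iff)
    moreover have "card {x. ?g (x ^ (q ^ j)) = (- \<beta> / \<alpha>) * ?h x} \<le> q ^ t'"
      unfolding q using assms gadd ghom ginj
      by (intro card_semilinear_kernel[where t = t, OF emb]) (auto simp: q)
    ultimately show ?thesis by simp
  qed
  have rank_ker: "card {x. f \<alpha> \<beta> x = 0} * q ^ rank (M \<alpha> \<beta>) = q ^ n" for \<alpha> \<beta>
    using card_kernel_rank[OF emb \<open>is_ext_basis \<iota> b\<close> lin[of \<alpha> \<beta>]] assms(1,4) by (simp add: M_def)
  have rank_ge: "n \<le> t' + rank (M \<alpha> \<beta>)" if "(\<alpha>, \<beta>) \<noteq> (0, 0)" for \<alpha> \<beta>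
  proof -
    have "q ^ n \<le> q ^ (t' + rank (M \<alpha> \<beta>))"
      using mult_right_mono[OF ker[OF that], of "q ^ rank (M \<alpha> \<beta>)"] by (simp add: rank_ker power_add)
    then show ?thesis using q1 by simp
  qed
  have rank0: "rank (0 :: 'k ^ 'n ^ 'n) = 0"
  proof -
    have "rows (0 :: 'k ^ 'n ^ 'n) \<subseteq> {0}" by (auto simp: rows_def row_def vec_eq_iff)
    then show ?thesis by (simp add: row_rank_def_gen)
  qed
  have Madd: "M \<alpha> \<beta> + M \<gamma> \<delta> = M (\<alpha> + \<gamma>) (\<beta> + \<delta>)" for \<alpha> \<beta> \<gamma> \<delta>
    unfolding M_def matrix_of_map_combination(1)[OF emb \<open>is_ext_basis \<iota> b\<close>, symmetric]
    by (rule arg_cong[where f = "matrix_of_map \<iota> b"]) (simp add: f_def algebra_simps)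
  have Mscale: "mat_smult c (M \<alpha> \<beta>) = M (\<iota> c * \<alpha>) (\<iota> c * \<beta>)" for c \<alpha> \<beta>
    unfolding M_def matrix_of_map_combination(2)[OF emb \<open>is_ext_basis \<iota> b\<close>, symmetric]
    by (rule arg_cong[where f = "matrix_of_map \<iota> b"]) (simp add: f_def algebra_simps)
  have M0: "M 0 0 = 0" using Madd[of 0 0 0 0] by simp
  have Mdiff: "M \<alpha> \<beta> - M \<gamma> \<delta> = M (\<alpha> - \<gamma>) (\<beta> - \<delta>)" for \<alpha> \<beta> \<gamma> \<delta>
    using Madd[of "\<alpha> - \<gamma>" "\<beta> - \<delta>" \<gamma> \<delta>] by (simp add: algebra_simps)
  \<comment> \<open>The rank is at least \<open>n - t'\<close>, which is positive because
    \<open>t \<ge> 2\<close>.\<close>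
  have M_nz: "M \<alpha> \<beta> \<noteq> 0" if "(\<alpha>, \<beta>) \<noteq> (0, 0)" for \<alpha> \<beta>
    using rank_ge[OF that] rank0 n by auto
  have MC: "M \<alpha> \<beta> \<in> C" for \<alpha> \<beta> by (auto simp: C_def)
  have CE: "\<exists>\<alpha> \<beta>. A = M \<alpha> \<beta>" if "A \<in> C" for A
    using that by (auto simp: C_def)
  have sub: "mat_vs.subspace C"
    unfolding mat_vs.subspace_def
  proof (intro conjI ballI allI)
    show "0 \<in> C" using MC[of 0 0] M0 by simp
  qed (auto dest!: CE simp: Madd Mscale MC)
  \<comment> \<open>Injectivity gives the code \<open>q ^ (2 * n)\<close> elements, from which its
    dimension is read off.\<close>
  have "inj (\<lambda>(\<alpha>, \<beta>). M \<alpha> \<beta>)"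
  proof (rule injI, clarify)
    fix \<alpha> \<beta> \<gamma> \<delta> assume "M \<alpha> \<beta> = M \<gamma> \<delta>"
    then have "M (\<alpha> - \<gamma>) (\<beta> - \<delta>) = 0" using Mdiff[of \<alpha> \<beta> \<gamma> \<delta>] by simp
    then show "\<alpha> = \<gamma> \<and> \<beta> = \<delta>" using M_nz[of "\<alpha> - \<gamma>" "\<beta> - \<delta>"] by auto
  qed
  then have "card C = q ^ (2 * n)"
    unfolding C_def using assms(2)
    by (simp add: card_image card_prod mult_2 power_add flip: UNIV_Times_UNIV)
  moreover have "card C = q ^ mat_vs.dim C"
    using card_subspace[OF mat_vs.vector_space_axioms sub] by (simp add: q)
  ultimately have dim: "mat_vs.dim C = 2 * CARD('n)"
    using q1 assms(4) by simp
  let ?D = "{rank (A - B) | A B. A \<in> C \<and> B \<in> C \<and> A \<noteq> B}"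
  \<comment> \<open>\<open>Min\<close> needs a finite nonempty set: there are only finitely many
    matrices here, and \<open>inD\<close> provides an element.\<close>
  have "?D \<subseteq> range (rank :: 'k ^ 'n ^ 'n \<Rightarrow> nat)" by auto
  then have finD: "finite ?D" by (rule finite_subset) simp
  have ge: "n \<le> t' + r" if rD: "r \<in> ?D" for r
  proof -
    obtain A B where AB: "r = rank (A - B)" "A \<in> C" "B \<in> C" "A \<noteq> B"
      using rD by blast
    obtain \<alpha> \<beta> \<gamma> \<delta> where "A = M \<alpha> \<beta>" "B = M \<gamma> \<delta>"
      using CE AB(2,3) by blast
    then show ?thesis using rank_ge[of "\<alpha> - \<gamma>" "\<beta> - \<delta>"] AB(1,4) by (auto simp: Mdiff)
  qed
  have nz: "M 1 (- ?g 1) \<noteq> 0" by (rule M_nz) simp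
  \<comment> \<open>The coefficient \<open>- ?g 1\<close> makes the codeword vanish at
    \<open>1\<close> as well as at \<open>0\<close>, since every power of \<open>1\<close> is
    \<open>1\<close>. Its rank, the distance to the zero codeword, is therefore below
    \<open>n\<close>.\<close>
  have "\<not> card {x. f 1 (- ?g 1) x = 0} \<le> 1"
    using card_mono[of "{x. f 1 (- ?g 1) x = 0}" "{0, 1}"] g0 q1
    by (auto simp: f_def power_0_left)
  then have "\<not> q ^ n \<le> q ^ rank (M 1 (- ?g 1))"
    using rank_ker[of 1 "- ?g 1", symmetric] q1 by simp
  then have lt: "rank (M 1 (- ?g 1)) < n" using q1 by simp
  have inD: "rank (M 1 (- ?g 1)) \<in> ?D"
    using MC[of 1 "- ?g 1"] MC[of 0 0] nz M0 by (intro CollectI exI[of _ "M 1 (- ?g 1)"] exI[of _ 0]) simp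
  have mn: "min_distance C \<in> ?D" "min_distance C \<le> n - 1"
    unfolding min_distance_def using Min_in[OF finD] Min_le[OF finD inD] inD lt by auto
  \<comment> \<open>The subtraction is not truncated because the minimum distance is at most
    \<open>n - 1\<close>; the lower bound \<open>n - t'\<close> on it gives
    \<open>s \<le> t' - 1\<close>.\<close>
  define s where "s = n - 1 - min_distance C"
  have "s + 1 \<le> t'" using ge[OF mn(1)] mn(2) n assms(8) by (simp add: s_def)
  moreover have "real n / real t = real t'" using assms(6,7) by simp
  moreover have "min_distance C + s = max_distance C"
    using mn(2) max_distance_dim_double[OF dim] assms(4) by (simp add: s_def)
  ultimately have "real s \<le> real n / real t - 1 \<and> almost_MRD s C"
    using sub nz MC by (auto simp: almost_MRD_def)
  then show ?thesis unfolding C by blast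
qed

end
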